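(* Let $m\ge3$, let $f_1,\dots,f_m\in\mathbb{D}[[x]]$, let $i,j,k\in\{1,\dots,m\}$ be distinct, and let $n\in\mathbb{Z}_{\ge-1}^m$ with $n_i,n_j,n_k\ge0$ be such that the quasideterminants $\rho^a(n)$ and $\rho^a(n-e_b)$ exist and are nonzero for all distinct $a,b\in\{i,j,k\}$. Then $$\rho^i(n)\,[\rho^i(n-e_j)]^{-1}+\rho^j(n)\,[\rho^j(n-e_k)]^{-1}+\rho^k(n)\,[\rho^k(n-e_i)]^{-1}=0.$$
   Context: $\mathbb{D}$ is a (not necessarily commutative) division ring; $f_i(x)=\sum_{j\ge0}f^i_jx^j$, $i=1,\dots,m$, are formal power series with coefficients $f^i_j\in\mathbb{D}$, where $x$ commutes with all elements of $\mathbb{D}$; put $f^i_j=0$ for $j<0$. For $n=(n_1,\dots,n_m)\in\mathbb{Z}_{\ge-1}^m$ write $|n|=n_1+\dots+n_m$; $e_i$ denotes the $i$th standard basis vector of $\mathbb{Z}^m$. Quasideterminant: for a square matrix $X$, let $X^{pq}$ be $X$ with row $p$ and column $q$ deleted. If $X^{pq}$ is invertible, $|X|_{pq}=x_{pq}-r\,(X^{pq})^{-1}c$, where $r$ is row $p$ of $X$ without its $q$th entry and $c$ is column $q$ of $X$ without its $p$th entry (for a $1\times1$ matrix, $|X|_{11}=x_{11}$); the quasideterminant is said to exist when $X^{pq}$ is invertible. When $X$ is invertible and $(X^{-1})_{qp}\ne0$, it equals $((X^{-1})_{qp})^{-1}$. Matrix $\mathcal{M}(n)$: it has $|n|+m-1$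 rows, indexed $r=0,\dots,|n|+m-2$, and $|n|+m$ columns divided into $m$ consecutive blocks; the $i$th block has $n_i+1$ columns indexed $c=0,\dots,n_i$ (empty if $n_i=-1$), and the entry in row $r$ and column $c$ of block $i$ is $f^i_{r-c}$. For $n_i\ge0$, $\rho^i(n)$ is the quasideterminant, with respect to the element in the last row and the last column of the $i$th block, of the square matrix obtained from $\mathcal{M}(n)$ by adding as last row the row $r=|n|+m-1$ given by the same rule (entries $f^l_{|n|+m-1-c}$, $c=0,\dots,n_l$, in block $l$). *)

theory Defs
  imports
    "HOL-Computational_Algebra.Formal_Power_Series"
    "Jordan_Normal_Form.Determinant"
begin

section \<open>Quasideterminants\<close>

text \<open>
  Rows and columns are indexed from 0. Scalar products multiply the entries of the left
  vector from the left, so the order of the factors is correct over a noncommutative ring.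
\<close>

text \<open>The choice is determined whenever \<open>invertible_mat A\<close> holds; see \<open>mat_inv_eqI\<close> below.\<close>

definition mat_inv :: "'a::semiring_1 mat \<Rightarrow> 'a mat" where
  "mat_inv A = (SOME B. inverts_mat A B \<and> inverts_mat B A)"

definition row_without :: "'a mat \<Rightarrow> nat \<Rightarrow> nat \<Rightarrow> 'a vec" where
  "row_without X p q = vec (dim_col X - 1) (\<lambda>j. X $$ (p, if j < q then j else Suc j))"

definition col_without :: "'a mat \<Rightarrow> nat \<Rightarrow> nat \<Rightarrow> 'a vec" where
  "col_without X p q = vec (dim_row X - 1) (\<lambda>i. X $$ (if i < p then i else Suc i, q))"

definition quasidet_exists :: "'a::division_ring mat \<Rightarrow> nat \<Rightarrow> nat \<Rightarrow> bool" where
  "quasidet_exists X p q \<longleftrightarrow>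
     square_mat X \<and> p < dim_row X \<and> q < dim_col X \<and> invertible_mat (mat_delete X p q)"

text \<open>
  Meaningful only if \<open>quasidet_exists X p q\<close>. For a \<open>1 \<times> 1\<close> matrix the deleted matrix is
  the (invertible) empty matrix and the value is the entry itself.
\<close>

definition quasidet :: "'a::division_ring mat \<Rightarrow> nat \<Rightarrow> nat \<Rightarrow> 'a" where
  "quasidet X p q =
     X $$ (p, q) - row_without X p q \<bullet> (mat_inv (mat_delete X p q) *\<^sub>v col_without X p q)"

lemma mat_inv_eqI:
  fixes A B :: "'a::semiring_1 mat"
  assumes "square_mat A" "inverts_mat A B" "inverts_mat B A"
  shows "mat_inv A = B"
proof -
  have carr: "C \<in> carrier_mat (dim_row A) (dim_row A)"
    if "inverts_mat A C" "inverts_mat C A" for C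
    using that assms(1) unfolding inverts_mat_def
    by (metis carrier_matI index_mult_mat(2,3) index_one_mat(2,3) square_mat.elims(2))
  let ?C = "mat_inv A"
  have C: "inverts_mat A ?C" "inverts_mat ?C A"
    using someI[of "\<lambda>B. inverts_mat A B \<and> inverts_mat B A" B] assms(2,3)
    unfolding mat_inv_def by auto
  note cC = carr[OF C] and cB = carr[OF assms(2,3)]
  have cA: "A \<in> carrier_mat (dim_row A) (dim_row A)" using assms(1) by auto
  have "?C = ?C * (A * B)"
    using cC assms(2) by (simp add: inverts_mat_def)
  also have "\<dots> = (?C * A) * B"
    using assoc_mult_mat[OF cC cA cB] by simp
  also have "\<dots> = B"
    using C(2) cB cC by (simp add: inverts_mat_def)
  finally show ?thesis .
qed

lemma quasidet_1x1:
  fixes X :: "'a::division_ring mat"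
  assumes "X \<in> carrier_mat 1 1"
  shows "quasidet_exists X 0 0" "quasidet X 0 0 = X $$ (0, 0)"
  using assms
  by (auto simp: quasidet_exists_def quasidet_def invertible_mat_def inverts_mat_def
      mat_delete_def row_without_def col_without_def scalar_prod_def mult_mat_vec_def
      intro!: exI[of _ "1\<^sub>m 0"])


section \<open>The matrices of the power series\<close>

text \<open>
  The series are \<open>f 1, \<dots>, f m\<close> and an index vector is \<open>n 1, \<dots>, n m\<close>; values of \<open>f\<close> and \<open>n\<close>
  outside \<open>{1..m}\<close> are irrelevant.
\<close>

definition fps_coeff :: "'a::zero fps \<Rightarrow> int \<Rightarrow> 'a" where
  "fps_coeff g k = (if k < 0 then 0 else fps_nth g (nat k))"

definition weight :: "nat \<Rightarrow> (nat \<Rightarrow> int) \<Rightarrow> int" where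
  "weight m n = (\<Sum>i=1..m. n i)"

text \<open>The columns in order, each given by its block \<open>i\<close> and its position \<open>c \<in> {0..n i}\<close> therein.\<close>

definition block_cols :: "nat \<Rightarrow> (nat \<Rightarrow> int) \<Rightarrow> (nat \<times> nat) list" where
  "block_cols m n = concat (map (\<lambda>i. map (\<lambda>c. (i, c)) [0..<nat (n i + 1)]) [1..<m + 1])"

definition num_cols :: "nat \<Rightarrow> (nat \<Rightarrow> int) \<Rightarrow> nat" where
  "num_cols m n = nat (weight m n + int m)"

definition series_row :: "(nat \<Rightarrow> 'a::zero fps) \<Rightarrow> nat \<Rightarrow> (nat \<Rightarrow> int) \<Rightarrow> nat \<Rightarrow> 'a vec" where
  "series_row f m n r =
     vec (num_cols m n) (\<lambda>q. let (i, c) = block_cols m n ! q in fps_coeff (f i) (int r - int c))"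

definition series_mat :: "(nat \<Rightarrow> 'a::zero fps) \<Rightarrow> nat \<Rightarrow> (nat \<Rightarrow> int) \<Rightarrow> 'a mat" where
  "series_mat f m n =
     mat_of_rows (num_cols m n) (map (series_row f m n) [0..<num_cols m n - 1])"

definition series_mat_ext :: "(nat \<Rightarrow> 'a::zero fps) \<Rightarrow> nat \<Rightarrow> (nat \<Rightarrow> int) \<Rightarrow> 'a mat" where
  "series_mat_ext f m n =
     mat_of_rows (num_cols m n)
       (rows (series_mat f m n) @ [series_row f m n (num_cols m n - 1)])"

text \<open>Position of the last column of block \<open>i\<close>; only used for \<open>n i \<ge> 0\<close>.\<close>

definition last_col :: "(nat \<Rightarrow> int) \<Rightarrow> nat \<Rightarrow> nat" where
  "last_col n i = (\<Sum>l=1..i. nat (n l + 1)) - 1"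

definition rho_exists ::
    "(nat \<Rightarrow> 'a::division_ring fps) \<Rightarrow> nat \<Rightarrow> nat \<Rightarrow> (nat \<Rightarrow> int) \<Rightarrow> bool" where
  "rho_exists f m i n \<longleftrightarrow>
     quasidet_exists (series_mat_ext f m n) (num_cols m n - 1) (last_col n i)"

definition rho :: "(nat \<Rightarrow> 'a::division_ring fps) \<Rightarrow> nat \<Rightarrow> nat \<Rightarrow> (nat \<Rightarrow> int) \<Rightarrow> 'a" where
  "rho f m i n = quasidet (series_mat_ext f m n) (num_cols m n - 1) (last_col n i)"

text \<open>The vector \<open>n - e\<^sub>b\<close>.\<close>

definition lower :: "(nat \<Rightarrow> int) \<Rightarrow> nat \<Rightarrow> nat \<Rightarrow> int" where
  "lower n b = n(b := n b - 1)"

lemma length_block_cols_aux: "length (block_cols m n) = (\<Sum>l=1..m. nat (n l + 1))"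
  by (induction m) (auto simp: block_cols_def)

lemma length_block_cols:
  assumes "\<And>l. l \<in> {1..m} \<Longrightarrow> n l \<ge> -1"
  shows "length (block_cols m n) = num_cols m n"
proof -
  have "int (length (block_cols m n)) = (\<Sum>l=1..m. n l + 1)"
    unfolding length_block_cols_aux of_nat_sum
    by (rule sum.cong) (use assms in \<open>force+\<close>)
  also have "\<dots> = weight m n + int m"
    by (simp add: weight_def sum.distrib)
  finally show ?thesis by (simp add: num_cols_def)
qed

lemma block_cols_last_col:
  assumes "i \<in> {1..m}" "n i \<ge> 0"
  shows "last_col n i < length (block_cols m n)"
    and "block_cols m n ! last_col n i = (i, nat (n i))"
proof -
  obtain k where k: "i = Suc k" using assms(1) by (cases i) auto
  have upt: "[1..<m + 1] = [1..<i] @ i # [Suc i..<m + 1]"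
    using assms(1) upt_add_eq_append[of 1 i "m + 1 - i"] upt_conv_Cons[of i "m + 1"] by simp
  let ?g = "\<lambda>i. map (\<lambda>c. (i, c)) [0..<nat (n i + 1)]"
  define zs where "zs = concat (map ?g [Suc i..<m + 1])"
  have split: "block_cols m n = block_cols k n @ ?g i @ zs"
    unfolding block_cols_def upt zs_def k by simp
  have last: "last_col n i = length (block_cols k n) + nat (n i)"
    unfolding last_col_def length_block_cols_aux k using assms(2) k by auto
  have g: "length (?g i) = Suc (nat (n i))" "?g i ! nat (n i) = (i, nat (n i))"
    using assms(2) by (auto simp del: upt_Suc)
  show "last_col n i < length (block_cols m n)"
    unfolding split last using g(1) by simp
  show "block_cols m n ! last_col n i = (i, nat (n i))"
    unfolding split last using g by (simp add: nth_append del: upt_Suc)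
qed

end

theory Submission
  imports Defs
begin

text \<open>
  The matrix \<open>\<M>(n)\<close> has a one-dimensional kernel, a right vector space; let \<open>v\<close> span it.
  If \<open>S\<close> is the value of the added row on \<open>v\<close> and \<open>v\<^sub>a\<close> is the coordinate of \<open>v\<close> at the last
  column of block \<open>a\<close>, then \<open>\<rho>\<^sup>a(n) = S v\<^sub>a\<^sup>-\<^sup>1\<close>. Apply this to \<open>n - e\<^sub>b\<close> too and extend the kernel
  vector by zero at the removed column: this gives vectors \<open>w\<^sup>b\<close> with \<open>w\<^sup>b\<^sub>b = 0\<close> that are
  annihilated by all rows of \<open>\<M>(n)\<close> except the last one, whose value on \<open>w\<^sup>b\<close> can be scaled to
  be \<open>1\<close>; then \<open>\<rho>\<^sup>a(n - e\<^sub>b)\<^sup>-\<^sup>1 = w\<^sup>b\<^sub>a\<close>. Now \<open>w\<^sup>b - w\<^sup>a\<close> lies in the kernel, and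
  \<open>w\<^sup>b - w\<^sup>a = v (v\<^sub>a\<^sup>-\<^sup>1 w\<^sup>b\<^sub>a)\<close> by comparison at the last column of block \<open>a\<close>. Since the three
  cyclic differences add up to zero, so do the factors \<open>v\<^sub>a\<^sup>-\<^sup>1 w\<^sup>b\<^sub>a\<close>.
\<close>

section \<open>Quasideterminants through linear systems\<close>

lemma sum_lessThan_insert_index:
  fixes g :: "nat \<Rightarrow> 'a::comm_monoid_add"
  assumes "q < N"
  shows "(\<Sum>j<N. g j) = g q + (\<Sum>j<N - 1. g (insert_index q j))"
proof -
  have img: "insert_index q ` {..<N - 1} = {..<N} - {q}"
    using insert_index_image[of q "N - 1"] assms by (simp add: lessThan_atLeast0)
  have "(\<Sum>j<N. g j) = g q + sum g ({..<N} - {q})"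
    using assms by (intro sum.remove) auto
  also have "sum g ({..<N} - {q}) = (\<Sum>j<N - 1. g (insert_index q j))"
    using sum.reindex[OF insert_index_inj_on[of q "{..<N - 1}"], of g]
    unfolding img o_def .
  finally show ?thesis .
qed

lemma mat_inv_inverse:
  fixes A :: "'a::semiring_1 mat"
  assumes "invertible_mat A" and "A \<in> carrier_mat d d"
  shows "mat_inv A \<in> carrier_mat d d" "A * mat_inv A = 1\<^sub>m d" "mat_inv A * A = 1\<^sub>m d"
proof -
  obtain B where sq: "square_mat A" and B: "inverts_mat A B" "inverts_mat B A"
    using assms(1) by (auto simp: invertible_mat_def)
  have AB: "A * B = 1\<^sub>m d" and BA: "B * A = 1\<^sub>m (dim_row B)"
    using B assms(2) by (auto simp: inverts_mat_def)
  have "dim_col B = d" "dim_row B = d"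
    using arg_cong[OF AB, of dim_col] arg_cong[OF BA, of dim_col] assms(2) by auto
  then show "mat_inv A \<in> carrier_mat d d" "A * mat_inv A = 1\<^sub>m d" "mat_inv A * A = 1\<^sub>m d"
    using AB BA mat_inv_eqI[OF sq B] by auto
qed

lemma mat_delete_entry:
  assumes "X \<in> carrier_mat N N" "i < N - 1" "j < N - 1"
  shows "mat_delete X p q $$ (i, j) = X $$ (insert_index p i, insert_index q j)"
  using assms by (auto simp: mat_delete_def insert_index_def)

text \<open>This replaces the inverse in the definition of \<open>quasidet\<close> by a vector:
  normalized to 1 at column \<open>q\<close> and annihilated by all rows but \<open>p\<close>, it
  takes the quasideterminant as its value on row \<open>p\<close>.\<close>

lemma quasidet_solution:
  fixes X :: "'a::division_ring mat"
  assumes X: "X \<in> carrier_mat N N" and ex: "quasidet_exists X p q"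
  obtains v where "v q = 1"
    and "\<And>i. i < N \<Longrightarrow> i \<noteq> p \<Longrightarrow> (\<Sum>j<N. X $$ (i, j) * v j) = 0"
    and "(\<Sum>j<N. X $$ (p, j) * v j) = quasidet X p q"
proof -
  define A where "A = mat_delete X p q"
  define c where "c = col_without X p q"
  define u where "u = mat_inv A *\<^sub>v c"
  \<comment> \<open>The coordinates off \<open>q\<close> are minus the solution of
    \<open>A u = c\<close>, so column \<open>q\<close> is cancelled in every row other than
    \<open>p\<close>.\<close>
  define v where "v j = (if j = q then 1 else - u $ delete_index q j)" for j
  have q: "q < N" "p < N" using ex X by (auto simp: quasidet_exists_def)
  have A: "A \<in> carrier_mat (N - 1) (N - 1)"
    using X unfolding A_def by (rule mat_delete_carrier)
  note inv = mat_inv_inverse[OF _ A]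
  have invA: "invertible_mat A" using ex by (simp add: quasidet_exists_def A_def)
  have c: "c \<in> carrier_vec (N - 1)" using X by (simp add: c_def col_without_def carrier_vecI)
  have u: "u \<in> carrier_vec (N - 1)" using inv(1)[OF invA] c by (simp add: u_def)
  have Au: "A *\<^sub>v u = c"
    using assoc_mult_mat_vec[OF A inv(1)[OF invA] c] inv(2)[OF invA] c by (simp add: u_def)
  have val: "(\<Sum>j<N. X $$ (i, j) * v j)
      = X $$ (i, q) - (\<Sum>j<N - 1. X $$ (i, insert_index q j) * u $ j)" for i
    unfolding sum_lessThan_insert_index[OF q(1)]
    by (simp add: v_def sum_negf)
  show thesis
  proof
    show "v q = 1" by (simp add: v_def)
    show "(\<Sum>j<N. X $$ (i, j) * v j) = 0" if i: "i < N" "i \<noteq> p" for i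
    proof -
      define i' where "i' = delete_index p i"
      have i': "i = insert_index p i'" "i' < N - 1"
        using i q by (auto simp: i'_def delete_index_def insert_index_def)
      have "X $$ (i, q) = c $ i'"
        using i' X by (simp add: c_def col_without_def insert_index_def)
      also have "\<dots> = (A *\<^sub>v u) $ i'" by (simp add: Au)
      also have "\<dots> = (\<Sum>j<N - 1. A $$ (i', j) * u $ j)"
        using A i'(2) u by (simp add: scalar_prod_def lessThan_atLeast0)
      also have "\<dots> = (\<Sum>j<N - 1. X $$ (i, insert_index q j) * u $ j)"
        using i' by (simp add: A_def mat_delete_entry[OF X])
      finally show ?thesis by (simp add: val)
    qed
    have "row_without X p q \<bullet> u = (\<Sum>j<N - 1. X $$ (p, insert_index q j) * u $ j)"
      using u X by (simp add: scalar_prod_def row_without_def insert_index_def lessThan_atLeast0)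
    then show "(\<Sum>j<N. X $$ (p, j) * v j) = quasidet X p q"
      by (simp add: val quasidet_def flip: A_def c_def u_def)
  qed
qed

text \<open>With the coordinate at \<open>q\<close> equal to zero, the other coordinates form a
  vector killed by the invertible matrix \<open>mat_delete X p q\<close>.\<close>

lemma quasidet_exists_unique:
  fixes X :: "'a::division_ring mat"
  assumes X: "X \<in> carrier_mat N N" and ex: "quasidet_exists X p q" and "v q = 0"
    and ker: "\<And>i. i < N \<Longrightarrow> i \<noteq> p \<Longrightarrow> (\<Sum>j<N. X $$ (i, j) * v j) = 0"
    and "j < N"
  shows "v j = 0"
proof (cases "j = q")
  case False
  define A where "A = mat_delete X p q"
  define u where "u = vec (N - 1) (\<lambda>j. v (insert_index q j))"
  have q: "q < N" "p < N" using ex X by (auto simp: quasidet_exists_def)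
  have A: "A \<in> carrier_mat (N - 1) (N - 1)"
    using X unfolding A_def by (rule mat_delete_carrier)
  have invA: "invertible_mat A" using ex by (simp add: quasidet_exists_def A_def)
  note inv = mat_inv_inverse[OF invA A]
  have u: "u \<in> carrier_vec (N - 1)" by (simp add: u_def)
  have Au: "A *\<^sub>v u = 0\<^sub>v (N - 1)"
  proof (rule eq_vecI)
    fix i assume "i < dim_vec (0\<^sub>v (N - 1) :: 'a vec)"
    then have i: "i < N - 1" by simp
    have "(A *\<^sub>v u) $ i = (\<Sum>j<N - 1. X $$ (insert_index p i, insert_index q j) * v (insert_index q j))"
      using A i u
      by (simp add: scalar_prod_def lessThan_atLeast0 u_def A_def carrier_matD[OF X] mat_delete_entry[OF X])
    also have "\<dots> = (\<Sum>j<N. X $$ (insert_index p i, j) * v j)"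
      by (simp add: sum_lessThan_insert_index[OF q(1)] \<open>v q = 0\<close>)
    also have "\<dots> = 0"
      using i by (intro ker) (auto simp: insert_index_def)
    finally show "(A *\<^sub>v u) $ i = 0\<^sub>v (N - 1) $ i" using i by simp
  qed (use A in simp)
  have "u = mat_inv A *\<^sub>v (A *\<^sub>v u)"
    using assoc_mult_mat_vec[OF inv(1) A u] inv(3) u by simp
  also have "\<dots> = 0\<^sub>v (N - 1)"
    unfolding Au using inv(1) by (intro eq_vecI) (auto simp: scalar_prod_def)
  finally have "u $ j' = 0" if "j' < N - 1" for j' using that by simp
  moreover have "delete_index q j < N - 1" "insert_index q (delete_index q j) = j"
    using False \<open>j < N\<close> q by (auto simp: delete_index_def insert_index_def)
  ultimately show ?thesis by (metis index_vec u_def)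
qed (simp add: \<open>v q = 0\<close>)

section \<open>Rows of the series matrices as right-linear forms\<close>

text \<open>Coordinates are indexed by pairs (block, position) instead of column numbers, so
  removing a column does not renumber the others and vectors for \<open>n\<close> and
  \<open>lower n b\<close> can be compared directly.\<close>

definition row_form :: "(nat \<Rightarrow> 'a::division_ring fps) \<Rightarrow> (nat \<times> nat) set \<Rightarrow> nat
    \<Rightarrow> (nat \<times> nat \<Rightarrow> 'a) \<Rightarrow> 'a" where
  "row_form f C r v = (\<Sum>x\<in>C. fps_coeff (f (fst x)) (int r - int (snd x)) * v x)"

lemma row_form_diff: "row_form f C r (\<lambda>x. v x - w x) = row_form f C r v - row_form f C r w"
  by (simp add: row_form_def right_diff_distrib sum_subtractf)

lemma row_form_scale: "row_form f C r (\<lambda>x. v x * c) = row_form f C r v * c"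
  by (simp add: row_form_def sum_distrib_right mult.assoc)

lemma set_block_cols: "set (block_cols m n) = {(l, c). l \<in> {1..m} \<and> c < nat (n l + 1)}"
  by (auto simp: block_cols_def)

lemma distinct_block_cols: "distinct (block_cols m n)"
proof (induction m)
  case (Suc m)
  have "block_cols (Suc m) n
      = block_cols m n @ map (\<lambda>c. (Suc m, c)) [0..<nat (n (Suc m) + 1)]"
    by (simp add: block_cols_def)
  then show ?case
    using Suc set_block_cols[of m n] by (auto simp: distinct_map inj_on_def)
qed (simp add: block_cols_def)

section \<open>The kernel of \<M>(n) and its link to \<rho>\<close>

locale index_vector =
  fixes f :: "nat \<Rightarrow> 'a::division_ring fps" and m :: nat and n :: "nat \<Rightarrow> int"
  assumes ge: "l \<in> {1..m} \<Longrightarrow> n l \<ge> -1"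
begin

abbreviation "N \<equiv> num_cols m n"
abbreviation "C \<equiv> set (block_cols m n)"

text \<open>For \<open>N = 0\<close> the added row would still be there, over no columns, and the
  matrix would not be square.\<close>

lemma series_mat_ext_carrier: "0 < N \<Longrightarrow> series_mat_ext f m n \<in> carrier_mat N N"
  by (auto simp: series_mat_ext_def series_mat_def intro!: carrier_matI)

lemma series_mat_ext_entry:
  assumes "r < N" "q < N"
  shows "series_mat_ext f m n $$ (r, q) =
    fps_coeff (f (fst (block_cols m n ! q))) (int r - int (snd (block_cols m n ! q)))"
proof -
  let ?rs = "map (series_row f m n) [0..<N - 1]"
  have "rows (series_mat f m n) = ?rs"
    unfolding series_mat_def by (rule rows_mat_of_rows) (auto simp: series_row_def)
  moreover have "(?rs @ [series_row f m n (N - 1)]) ! r = series_row f m n r"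
    using assms(1) by (cases "r = N - 1") (auto simp: nth_append)
  ultimately show ?thesis
    using assms by (simp add: series_mat_ext_def mat_of_rows_index series_row_def case_prod_beta)
qed

text \<open>\<open>block_cols\<close> lists the pairs without repetition, hence is a bijection
  between column numbers and pairs.\<close>

lemma row_form_series_mat_ext:
  assumes "r < N"
  shows "(\<Sum>q<N. series_mat_ext f m n $$ (r, q) * v (block_cols m n ! q)) = row_form f C r v"
proof -
  have "bij_betw ((!) (block_cols m n)) {..<N} C"
    using length_block_cols[of m n] ge by (intro bij_betw_nth distinct_block_cols) auto
  from sum.reindex_bij_betw[OF this] show ?thesis
    using assms by (simp add: row_form_def series_mat_ext_entry)
qed

context
  fixes a :: nat
  assumes a: "a \<in> {1..m}" "n a \<ge> 0" and ex: "rho_exists f m a n"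
begin

lemma last_col_less: "last_col n a < N"
  using block_cols_last_col(1)[of a m n, OF a] length_block_cols[of m n] ge by simp

lemma rho_solution:
  obtains v where "v (a, nat (n a)) = 1"
    and "\<And>r. r < N - 1 \<Longrightarrow> row_form f C r v = 0"
    and "row_form f C (N - 1) v = rho f m a n"
proof -
  let ?X = "series_mat_ext f m n" and ?cs = "block_cols m n"
  have pos: "0 < N" using last_col_less by simp
  obtain u where u: "u (last_col n a) = 1"
      "\<And>i. i < N \<Longrightarrow> i \<noteq> N - 1 \<Longrightarrow> (\<Sum>j<N. ?X $$ (i, j) * u j) = 0"
      "(\<Sum>j<N. ?X $$ (N - 1, j) * u j) = rho f m a n"
    using quasidet_solution[OF series_mat_ext_carrier[OF pos] ex[unfolded rho_exists_def]]
    unfolding rho_def by blast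
  have inj: "inj_on ((!) ?cs) {..<N}"
    using length_block_cols[of m n] ge by (intro inj_on_nth distinct_block_cols) auto
  \<comment> \<open>This transports \<open>u\<close> from column numbers to pairs; values outside
    \<open>C\<close> do not enter any form.\<close>
  define v where "v x = u (the_inv_into {..<N} ((!) ?cs) x)" for x
  have v: "v (?cs ! q) = u q" if "q < N" for q
    using that by (simp add: v_def the_inv_into_f_f[OF inj])
  have form: "row_form f C r v = (\<Sum>q<N. ?X $$ (r, q) * u q)" if "r < N" for r
    using row_form_series_mat_ext[OF that, of v] v by simp
  show thesis
  proof
    show "v (a, nat (n a)) = 1"
      using v[OF last_col_less] u(1) block_cols_last_col(2)[of a m n, OF a] by simp
  qed (use form u last_col_less in auto)
qed

lemma rho_exists_unique:
  assumes "v (a, nat (n a)) = 0" and "\<And>r. r < N - 1 \<Longrightarrow> row_form f C r v = 0"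
    and "x \<in> C"
  shows "v x = 0"
proof -
  obtain q where q: "q < N" "x = block_cols m n ! q"
    using \<open>x \<in> C\<close> length_block_cols[of m n] ge by (auto simp: in_set_conv_nth)
  show ?thesis
    unfolding q(2)
  proof (rule quasidet_exists_unique[OF series_mat_ext_carrier, where v = "\<lambda>q. v (block_cols m n ! q)"])
    show "quasidet_exists (series_mat_ext f m n) (N - 1) (last_col n a)"
      using ex by (simp add: rho_exists_def)
    show "v (block_cols m n ! last_col n a) = 0"
      using assms(1) block_cols_last_col(2)[of a m n, OF a] by simp
  qed (use q assms row_form_series_mat_ext in auto)
qed

text \<open>The factor is chosen so that the difference of both sides vanishes at the last column of
  block \<open>a\<close>; \<open>rho_exists_unique\<close> then makes it zero on \<open>C\<close>.
  Scalars act from the right because the matrix entries act from the left.\<close>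

lemma kernel_proportional:
  assumes "\<And>r. r < N - 1 \<Longrightarrow> row_form f C r v = 0" "v (a, nat (n a)) \<noteq> 0"
    and "\<And>r. r < N - 1 \<Longrightarrow> row_form f C r u = 0" and "x \<in> C"
  shows "u x = v x * (inverse (v (a, nat (n a))) * u (a, nat (n a)))"
proof -
  let ?\<alpha> = "inverse (v (a, nat (n a))) * u (a, nat (n a))"
  have "u x - v x * ?\<alpha> = 0"
    by (rule rho_exists_unique[where v = "\<lambda>x. u x - v x * ?\<alpha>"])
      (use assms in \<open>auto simp: row_form_diff row_form_scale simp flip: mult.assoc\<close>)
  then show ?thesis by simp
qed

lemma rho_eq:
  assumes "\<And>r. r < N - 1 \<Longrightarrow> row_form f C r v = 0" "v (a, nat (n a)) \<noteq> 0"
  shows "rho f m a n = row_form f C (N - 1) v * inverse (v (a, nat (n a)))"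
proof -
  obtain w where w: "w (a, nat (n a)) = 1" "\<And>r. r < N - 1 \<Longrightarrow> row_form f C r w = 0"
      "row_form f C (N - 1) w = rho f m a n"
    using rho_solution by blast
  \<comment> \<open>The normalized solution and the rescaled \<open>v\<close> need only agree on
    \<open>C\<close>, so they are compared under the sum.\<close>
  have "row_form f C (N - 1) w = row_form f C (N - 1) (\<lambda>x. v x * inverse (v (a, nat (n a))))"
    unfolding row_form_def
  proof (rule sum.cong[OF refl])
    fix x assume "x \<in> C"
    from kernel_proportional[OF assms w(2) this] w(1)
    show "fps_coeff (f (fst x)) (int (N - 1) - int (snd x)) * w x
      = fps_coeff (f (fst x)) (int (N - 1) - int (snd x)) * (v x * inverse (v (a, nat (n a))))"
      by simp
  qed
  then show ?thesis unfolding w(3) row_form_scale .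
qed

end

section \<open>Vectors obtained from n - e_b\<close>

lemma lower_solution:
  assumes "a \<in> {1..m}" "n a \<ge> 0" "b \<in> {1..m}" "n b \<ge> 0" "a \<noteq> b"
    and "rho_exists f m a (lower n b)" and nz: "rho f m a (lower n b) \<noteq> 0"
  obtains w where "w (b, nat (n b)) = 0"
    and "w (a, nat (n a)) = inverse (rho f m a (lower n b))"
    and "\<And>r. r < N - 1 \<Longrightarrow> row_form f C r w = (if r = N - 2 then 1 else 0)"
proof -
  let ?n = "lower n b" and ?c = "(b, nat (n b))"
  let ?C = "set (block_cols m ?n)" and ?\<rho> = "rho f m a (lower n b)"
  \<comment> \<open>The bound \<open>n b \<ge> 0\<close> keeps the lowered entry at least
    -1.\<close>
  interpret low: index_vector f m ?n
    by unfold_locales (use ge assms in \<open>auto simp: lower_def\<close>)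
  have "weight m ?n = weight m n - 1"
    using assms(3) sum.remove[of "{1..m}" b n] sum.remove[of "{1..m}" b ?n]
    by (simp add: weight_def lower_def)
  then have N: "num_cols m ?n = N - 1" by (simp add: num_cols_def nat_diff_distrib)
  have C: "?C = C - {?c}" and c: "?c \<in> C"
    using assms(3,4) by (auto simp: set_block_cols lower_def split: if_splits)
  \<comment> \<open>So the row added to the matrix of \<open>lower n b\<close> is row
    \<open>N - 2\<close>, the last row of \<M>(n).\<close>
  have N2: "num_cols m ?n - 1 = N - 2" using N by simp
  have lower_a: "?n a = n a" using assms(5) by (simp add: lower_def)
  obtain u where u: "u (a, nat (n a)) = 1"
      "\<And>r. r < N - 2 \<Longrightarrow> row_form f ?C r u = 0" "row_form f ?C (N - 2) u = ?\<rho>"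
    using low.rho_solution[OF assms(1) _ assms(6)] assms(2) unfolding lower_a N2 by metis
  \<comment> \<open>Zero is put at the removed column, and the right factor scales the value on row
    \<open>N - 2\<close> to 1.\<close>
  define w where "w x = (u(?c := 0)) x * inverse ?\<rho>" for x
  have form: "row_form f C r w = row_form f ?C r u * inverse ?\<rho>" for r
  proof -
    have "row_form f C r (u(?c := 0)) = row_form f ?C r u"
      using c sum.remove[of C ?c "\<lambda>x. fps_coeff (f (fst x)) (int r - int (snd x)) * (u(?c := 0)) x"]
      by (simp add: row_form_def C)
    then show ?thesis unfolding w_def[abs_def] row_form_scale by (rule arg_cong)
  qed
  show thesis
  proof
    show "w ?c = 0" "w (a, nat (n a)) = inverse ?\<rho>"
      using u(1) assms(5) by (auto simp: w_def)
    show "row_form f C r w = (if r = N - 2 then 1 else 0)" if "r < N - 1" for r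
      using that u(2)[of r] u(3) nz by (auto simp: form)
  qed
qed

end

section \<open>The three-term relation\<close>

theorem corollary3p7:
  fixes f :: "nat \<Rightarrow> 'a::division_ring fps"
    and m i j k :: nat
    and n :: "nat \<Rightarrow> int"
  assumes "m \<ge> 3"
    and "i \<in> {1..m}" and "j \<in> {1..m}" and "k \<in> {1..m}"
    and "i \<noteq> j" and "j \<noteq> k" and "i \<noteq> k"
    and "\<And>l. l \<in> {1..m} \<Longrightarrow> n l \<ge> -1"
    and "n i \<ge> 0" and "n j \<ge> 0" and "n k \<ge> 0"
    and "\<And>a. a \<in> {i, j, k} \<Longrightarrow> rho_exists f m a n \<and> rho f m a n \<noteq> 0"
    and "\<And>a b. a \<in> {i, j, k} \<Longrightarrow> b \<in> {i, j, k} \<Longrightarrow> a \<noteq> b \<Longrightarrow>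
           rho_exists f m a (lower n b) \<and> rho f m a (lower n b) \<noteq> 0"
  shows "rho f m i n * inverse (rho f m i (lower n j))
       + rho f m j n * inverse (rho f m j (lower n k))
       + rho f m k n * inverse (rho f m k (lower n i)) = 0"
proof -
  interpret index_vector f m n by unfold_locales (rule assms(8))
  let ?c = "\<lambda>a. (a, nat (n a))"
  have a: "a \<in> {1..m}" "n a \<ge> 0" "rho_exists f m a n" if "a \<in> {i, j, k}" for a
    using that assms(2-4,9-12) by auto
  have c: "?c a \<in> C" if "a \<in> {i, j, k}" for a
    using a[OF that] by (auto simp: set_block_cols)
  obtain v where v: "v (?c i) = 1" "\<And>r. r < N - 1 \<Longrightarrow> row_form f C r v = 0"
    using rho_solution[OF a, of i] by (metis insertI1)
  \<comment> \<open>Were this coordinate zero, uniqueness for block \<open>a\<close> would force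
    \<open>v (?c i) = 0\<close>, but it is 1. Hence one kernel vector serves all three
    blocks.\<close>
  have v0: "v (?c a) \<noteq> 0" if "a \<in> {i, j, k}" for a
    using rho_exists_unique[OF a[OF that], where v = v and x = "?c i"] v c[of i] by auto
  define S where "S = row_form f C (N - 1) v"
  have rho: "rho f m a n = S * inverse (v (?c a))" if "a \<in> {i, j, k}" for a
    unfolding S_def by (rule rho_eq[OF a[OF that] v(2) v0[OF that]])
  have ex: "\<exists>w. w (?c b) = 0 \<and> w (?c a) = inverse (rho f m a (lower n b)) \<and>
      (\<forall>r<N - 1. row_form f C r w = (if r = N - 2 then 1 else 0))"
    if "a \<in> {i, j, k}" "b \<in> {i, j, k}" "a \<noteq> b" for a b
    using lower_solution[OF a(1,2)[OF that(1)] a(1,2)[OF that(2)] that(3)] assms(13)[OF that]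
    by metis
  obtain wi wj wk where
    wi: "wi (?c i) = 0" "wi (?c k) = inverse (rho f m k (lower n i))"
      "\<forall>r<N - 1. row_form f C r wi = (if r = N - 2 then 1 else 0)" and
    wj: "wj (?c j) = 0" "wj (?c i) = inverse (rho f m i (lower n j))"
      "\<forall>r<N - 1. row_form f C r wj = (if r = N - 2 then 1 else 0)" and
    wk: "wk (?c k) = 0" "wk (?c j) = inverse (rho f m j (lower n k))"
      "\<forall>r<N - 1. row_form f C r wk = (if r = N - 2 then 1 else 0)"
    using ex[of k i] ex[of i j] ex[of j k] assms(5-7) by auto
  \<comment> \<open>Both vectors have the same row values, so \<open>w - w'\<close> lies in the
    kernel. Its factor relative to \<open>v\<close> is read off at \<open>?c i\<close>, where
    \<open>v\<close> is 1, and at \<open>?c a\<close>, where \<open>w'\<close> vanishes.\<close>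
  have diff: "w (?c i) - w' (?c i) = inverse (v (?c a)) * w (?c a)"
    if "a \<in> {i, j, k}" "w' (?c a) = 0"
      "\<forall>r<N - 1. row_form f C r w = (if r = N - 2 then 1 else 0)"
      "\<forall>r<N - 1. row_form f C r w' = (if r = N - 2 then 1 else 0)" for a w w'
    using kernel_proportional[OF a[OF that(1)] v(2) v0[OF that(1)], where u = "\<lambda>x. w x - w' x"]
      that c[of i] v(1) by (simp add: row_form_diff)
  \<comment> \<open>Each subtracted vector is the one that vanishes in the block at hand; the
    right-hand sides telescope.\<close>
  have cyc: "inverse (v (?c i)) * wj (?c i) = wj (?c i) - wi (?c i)"
      "inverse (v (?c j)) * wk (?c j) = wk (?c i) - wj (?c i)"
      "inverse (v (?c k)) * wi (?c k) = wi (?c i) - wk (?c i)"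
    by (rule diff[symmetric]; use wi wj wk in blast)+
  have "inverse (v (?c i)) * wj (?c i) + inverse (v (?c j)) * wk (?c j)
      + inverse (v (?c k)) * wi (?c k) = 0"
    unfolding cyc by simp
  \<comment> \<open>Multiplication by \<open>S\<close> from the left turns each
    \<open>inverse (v (?c a))\<close> into \<open>rho f m a n\<close>.\<close>
  then have "S * (inverse (v (?c i)) * wj (?c i) + inverse (v (?c j)) * wk (?c j)
      + inverse (v (?c k)) * wi (?c k)) = 0"
    by simp
  then show ?thesis
    by (simp add: rho wi(2) wj(2) wk(2) distrib_left mult.assoc)
qed

end
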